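(* Let $n\ge 2$ be an integer. There is a unique left group action $GE$ of the braid group $B_n$ on the set $[n]\times\mathbb{Z}$ such that for all $k\in\{1,\dots,n-1\}$ and all $(a,b)\in[n]\times\mathbb{Z}$, $$GE(\sigma_k,(a,b))=\begin{cases}(a,b) & a\notin\{k,k+1\},\\ (k+1,b) & a=k,\\ (k,b+1) & a=k+1.\end{cases}$$
   Context: $[n]=\{1,\dots,n\}$. $B_n$ is the braid group on $n$ strands, with presentation by the Artin generators $\sigma_1,\dots,\sigma_{n-1}$ subject to $\sigma_i\sigma_{i+1}\sigma_i=\sigma_{i+1}\sigma_i\sigma_{i+1}$ for all $1\le i\le n-2$ and $\sigma_i\sigma_j=\sigma_j\sigma_i$ whenever $|i-j|>1$. The action $GE$ is called the Gauss-Epple action. *)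

theory Defs
  imports "HOL-Algebra.Group_Action"
begin

section \<open>Groups given by generators and relations\<close>

text \<open>The letter \<open>(x, True)\<close> stands for the generator \<open>x\<close>, the letter
  \<open>(x, False)\<close> for its formal inverse.\<close>

type_synonym 'a word = "('a \<times> bool) list"

definition words :: "'a set \<Rightarrow> 'a word set" where
  "words S = lists (S \<times> UNIV)"

text \<open>The congruence on words generated by free cancellation and by the relations
  \<open>r = s\<close> for \<open>(r, s) \<in> R\<close>.\<close>

inductive_set pres_cong :: "'a set \<Rightarrow> ('a word \<times> 'a word) set \<Rightarrow> ('a word \<times> 'a word) set"
  for S :: "'a set" and R :: "('a word \<times> 'a word) set"
where
  refl: "u \<in> words S \<Longrightarrow> (u, u) \<in> pres_cong S R"
| sym: "(u, v) \<in> pres_cong S R \<Longrightarrow> (v, u) \<in> pres_cong S R"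
| trans: "(u, v) \<in> pres_cong S R \<Longrightarrow> (v, w) \<in> pres_cong S R \<Longrightarrow> (u, w) \<in> pres_cong S R"
| cancel: "u \<in> words S \<Longrightarrow> v \<in> words S \<Longrightarrow> x \<in> S \<Longrightarrow>
    (u @ [(x, e), (x, \<not> e)] @ v, u @ v) \<in> pres_cong S R"
| rel: "u \<in> words S \<Longrightarrow> v \<in> words S \<Longrightarrow> r \<in> words S \<Longrightarrow> s \<in> words S \<Longrightarrow> (r, s) \<in> R \<Longrightarrow>
    (u @ r @ v, u @ s @ v) \<in> pres_cong S R"

definition presented_group :: "'a set \<Rightarrow> ('a word \<times> 'a word) set \<Rightarrow> 'a word set monoid" where
  "presented_group S R =
    \<lparr>carrier = words S // pres_cong S R,
     mult = (\<lambda>A B. \<Union>a\<in>A. \<Union>b\<in>B. pres_cong S R `` {a @ b}),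
     one = pres_cong S R `` {[]}\<rparr>"

lemma pres_cong_words:
  assumes "(u, v) \<in> pres_cong S R"
  shows "u \<in> words S" "v \<in> words S"
  using assms by (induction rule: pres_cong.induct) (auto simp: words_def)

lemma equiv_pres_cong: "equiv (words S) (pres_cong S R)"
  by (intro equivI refl_onI symI transI subsetI)
     (auto intro: pres_cong.intros dest: pres_cong_words)

lemma pres_cong_append:
  assumes "(u, u') \<in> pres_cong S R" "(v, v') \<in> pres_cong S R"
  shows "(u @ v, u' @ v') \<in> pres_cong S R"
proof -
  have ctx: "(a @ x @ b, a @ y @ b) \<in> pres_cong S R"
    if "(x, y) \<in> pres_cong S R" "a \<in> words S" "b \<in> words S" for a b x y
    using that
  proof (induction rule: pres_cong.induct)
    case (refl u)
    then show ?case by (intro pres_cong.refl) (auto simp: words_def)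
  next
    case (sym u v)
    then show ?case by (blast intro: pres_cong.sym)
  next
    case (trans u v w)
    then show ?case by (blast intro: pres_cong.trans)
  next
    case (cancel u v x e)
    then show ?case
      using pres_cong.cancel[of "a @ u" S "v @ b" x e R] by (auto simp: words_def)
  next
    case (rel u v r s)
    then show ?case
      using pres_cong.rel[of "a @ u" S "v @ b" r s R] by (auto simp: words_def)
  qed
  have "(u @ v, u' @ v) \<in> pres_cong S R"
    using ctx[OF assms(1), of "[]" v] pres_cong_words[OF assms(2)] by (auto simp: words_def)
  moreover have "(u' @ v, u' @ v') \<in> pres_cong S R"
    using ctx[OF assms(2), of u' "[]"] pres_cong_words[OF assms(1)] by (auto simp: words_def)
  ultimately show ?thesis by (rule pres_cong.trans)
qed

lemma presented_group_mult:
  assumes "u \<in> words S" "v \<in> words S"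
  shows "(pres_cong S R `` {u}) \<otimes>\<^bsub>presented_group S R\<^esub> (pres_cong S R `` {v})
       = pres_cong S R `` {u @ v}"
proof -
  have "pres_cong S R `` {a @ b} = pres_cong S R `` {u @ v}"
    if "(u, a) \<in> pres_cong S R" "(v, b) \<in> pres_cong S R" for a b
    using equiv_class_eq[OF equiv_pres_cong pres_cong_append[OF that]] by simp
  then show ?thesis
    using assms by (auto simp: presented_group_def intro: pres_cong.refl)
qed

definition inv_word :: "'a word \<Rightarrow> 'a word" where
  "inv_word w = rev (map (\<lambda>(x, e). (x, \<not> e)) w)"

lemma inv_word_words: "w \<in> words S \<Longrightarrow> inv_word w \<in> words S"
  by (auto simp: inv_word_def words_def)

lemma inv_word_cong: "w \<in> words S \<Longrightarrow> (inv_word w @ w, []) \<in> pres_cong S R"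
proof (induction w)
  case Nil
  then show ?case by (auto simp: inv_word_def intro: pres_cong.refl)
next
  case (Cons p w)
  obtain x e where p: "p = (x, e)" by (cases p)
  have w: "w \<in> words S" "x \<in> S" using Cons.prems p by (auto simp: words_def)
  have "(inv_word w @ [(x, \<not> e), (x, \<not> \<not> e)] @ w, inv_word w @ w) \<in> pres_cong S R"
    using w inv_word_words by (intro pres_cong.cancel) auto
  with Cons.IH[OF w(1)] show ?case
    by (auto simp: p inv_word_def intro: pres_cong.trans)
qed

lemma group_presented_group: "group (presented_group S R)"
proof -
  have cls: "pres_cong S R `` {u} \<in> carrier (presented_group S R)" if "u \<in> words S" for u
    using that by (auto simp: presented_group_def quotient_def)
  have ex: "\<exists>u \<in> words S. A = pres_cong S R `` {u}" if "A \<in> carrier (presented_group S R)" for A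
    using that by (auto simp: presented_group_def quotient_def)
  have one: "\<one>\<^bsub>presented_group S R\<^esub> = pres_cong S R `` {[]}"
    by (simp add: presented_group_def)
  have nil: "[] \<in> words S" and app: "\<And>u v. u \<in> words S \<Longrightarrow> v \<in> words S \<Longrightarrow> u @ v \<in> words S"
    by (auto simp: words_def)
  show ?thesis
  proof (rule groupI)
    fix A B assume "A \<in> carrier (presented_group S R)" "B \<in> carrier (presented_group S R)"
    then show "A \<otimes>\<^bsub>presented_group S R\<^esub> B \<in> carrier (presented_group S R)"
      using ex cls app presented_group_mult by metis
  next
    show "\<one>\<^bsub>presented_group S R\<^esub> \<in> carrier (presented_group S R)"
      using cls nil one by metis
  next
    fix A B C
    assume "A \<in> carrier (presented_group S R)" "B \<in> carrier (presented_group S R)"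
      "C \<in> carrier (presented_group S R)"
    then obtain u v w where "u \<in> words S" "v \<in> words S" "w \<in> words S"
      "A = pres_cong S R `` {u}" "B = pres_cong S R `` {v}" "C = pres_cong S R `` {w}"
      using ex by metis
    then show "A \<otimes>\<^bsub>presented_group S R\<^esub> B \<otimes>\<^bsub>presented_group S R\<^esub> C
        = A \<otimes>\<^bsub>presented_group S R\<^esub> (B \<otimes>\<^bsub>presented_group S R\<^esub> C)"
      by (simp add: presented_group_mult app)
  next
    fix A assume "A \<in> carrier (presented_group S R)"
    then obtain u where u: "u \<in> words S" "A = pres_cong S R `` {u}"
      using ex by metis
    show "\<one>\<^bsub>presented_group S R\<^esub> \<otimes>\<^bsub>presented_group S R\<^esub> A = A"
      using u by (simp add: one presented_group_mult nil)
    have "pres_cong S R `` {inv_word u @ u} = pres_cong S R `` {[]}"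
      by (rule equiv_class_eq[OF equiv_pres_cong inv_word_cong[OF u(1)]])
    then show "\<exists>B \<in> carrier (presented_group S R).
        B \<otimes>\<^bsub>presented_group S R\<^esub> A = \<one>\<^bsub>presented_group S R\<^esub>"
      using u cls inv_word_words one presented_group_mult by metis
  qed
qed

section \<open>The braid group\<close>

definition braid_relations :: "nat \<Rightarrow> (nat word \<times> nat word) set" where
  "braid_relations n =
     {([(i, True), (i + 1, True), (i, True)], [(i + 1, True), (i, True), (i + 1, True)]) | i.
        1 \<le> i \<and> i + 2 \<le> n} \<union>
     {([(i, True), (j, True)], [(j, True), (i, True)]) | i j.
        i \<in> {1..n - 1} \<and> j \<in> {1..n - 1} \<and> \<bar>int i - int j\<bar> > 1}"

definition braid_group :: "nat \<Rightarrow> nat word set monoid" where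
  "braid_group n = presented_group {1..n - 1} (braid_relations n)"

text \<open>The Artin generator \<open>\<sigma>\<^sub>k\<close> of \<open>B\<^sub>n\<close>; meaningful for \<open>1 \<le> k \<le> n - 1\<close> only.\<close>

definition artin :: "nat \<Rightarrow> nat \<Rightarrow> nat word set" where
  "artin n k = pres_cong {1..n - 1} (braid_relations n) `` {[(k, True)]}"

lemma group_braid_group: "group (braid_group n)"
  unfolding braid_group_def by (rule group_presented_group)

end

theory Submission
  imports Defs
begin

text \<open>
  A homomorphism out of a group given by generators and relations is the same thing as an
  assignment of values to the generators under which the two sides of every relation get equal
  values (\<open>presented_group_universal\<close>). An action of \<open>B\<^sub>n\<close> on a set is a homomorphism
  into the group of its permutations, so an action with prescribed effect of the Artin generators
  exists, and is then unique, as soon as the prescribed maps are permutations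
  (\<open>gauss_epple_Bij\<close>) that satisfy the braid relation (\<open>gauss_epple_braid\<close>) and the
  far commutation relation (\<open>gauss_epple_commute\<close>).

  The braid relation can be seen as follows. Think of \<open>(a, b)\<close> as a token on the strand at
  position \<open>a\<close>, with a counter \<open>b\<close>. The generator \<open>\<sigma>\<^sub>k\<close> exchanges the strands at the
  positions \<open>k\<close> and \<open>k + 1\<close>, and the counter goes up by one each time the token moves to
  the left. Both sides of the braid relation reverse the three strands at the positions \<open>k\<close>,
  \<open>k + 1\<close>, \<open>k + 2\<close>, and each pair of these strands crosses exactly once; hence the token
  moves to the left once for each of the strands that start on its left, whichever order of the
  crossings is chosen. Far commutation holds because the two generators involved move tokens at
  disjoint pairs of positions.
\<close>

section \<open>Homomorphisms out of a presented group\<close>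

fun word_eval :: "('b, 'm) monoid_scheme \<Rightarrow> ('a \<Rightarrow> 'b) \<Rightarrow> 'a word \<Rightarrow> 'b" where
  "word_eval H f [] = \<one>\<^bsub>H\<^esub>"
| "word_eval H f ((x, e) # w) = (if e then f x else inv\<^bsub>H\<^esub> f x) \<otimes>\<^bsub>H\<^esub> word_eval H f w"

context group
begin

lemma word_eval_closed:
  assumes "f \<in> S \<rightarrow> carrier G" "w \<in> words S"
  shows "word_eval G f w \<in> carrier G"
  using assms(2)
proof (induction w)
  case (Cons p w)
  then show ?case using assms(1) by (cases p) (auto simp: words_def)
qed simp

lemma word_eval_append:
  assumes "f \<in> S \<rightarrow> carrier G" "u \<in> words S" "v \<in> words S"
  shows "word_eval G f (u @ v) = word_eval G f u \<otimes> word_eval G f v"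
  using assms(2)
proof (induction u)
  case Nil
  then show ?case using assms by (simp add: word_eval_closed)
next
  case (Cons p u)
  obtain x e where p: "p = (x, e)" by (cases p)
  have "f x \<in> carrier G" "u \<in> words S"
    using Cons.prems assms(1) by (auto simp: p words_def)
  then show ?case
    using Cons.IH assms word_eval_closed[of f S u] word_eval_closed[of f S v]
    by (simp add: p m_assoc)
qed

lemma word_eval_pres_cong:
  assumes f: "f \<in> S \<rightarrow> carrier G"
    and R: "\<And>r s. (r, s) \<in> R \<Longrightarrow> word_eval G f r = word_eval G f s"
    and "(u, v) \<in> pres_cong S R"
  shows "word_eval G f u = word_eval G f v"
  using assms(3)
proof (induction rule: pres_cong.induct)
  case (cancel u v x e)
  have x: "f x \<in> carrier G" using f cancel by auto
  have mid: "[(x, e), (x, \<not> e)] \<in> words S" using cancel by (auto simp: words_def)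
  have "word_eval G f [(x, e), (x, \<not> e)] = \<one>" using x by simp
  moreover have "[(x, e), (x, \<not> e)] @ v \<in> words S" using mid cancel by (auto simp: words_def)
  ultimately show ?case
    using cancel mid f word_eval_closed[of f S u] word_eval_closed[of f S v]
    by (simp only: word_eval_append[of f S] l_one)
next
  case (rel u v r s)
  then have "r @ v \<in> words S" "s @ v \<in> words S" by (auto simp: words_def)
  then show ?case using rel R[of r s] f by (simp add: word_eval_append[of f S])
qed auto

end

lemma presented_group_carrierE:
  assumes "A \<in> carrier (presented_group S R)"
  obtains u where "u \<in> words S" "A = pres_cong S R `` {u}"
  using assms by (auto simp: presented_group_def quotient_def)

lemma pres_cong_class_in_carrier:
  "u \<in> words S \<Longrightarrow> pres_cong S R `` {u} \<in> carrier (presented_group S R)"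
  by (auto simp: presented_group_def quotient_def)

text \<open>Every class is a product of generators and their inverses, because the class of a formal
  inverse letter is the inverse of the class of the letter.\<close>

lemma hom_presented_group_word_eval:
  assumes "group H" "\<phi> \<in> hom (presented_group S R) H" "u \<in> words S"
  shows "\<phi> (pres_cong S R `` {u}) = word_eval H (\<lambda>x. \<phi> (pres_cong S R `` {[(x, True)]})) u"
  using assms(3)
proof (induction u)
  let ?P = "presented_group S R" and ?c = "\<lambda>u. pres_cong S R `` {u}"
  interpret P: group ?P by (rule group_presented_group)
  interpret H: group H by fact
  interpret group_hom ?P H \<phi> by unfold_locales (rule assms(2))
  {
    case Nil
    have "?c [] = \<one>\<^bsub>?P\<^esub>" by (simp add: presented_group_def)
    then show ?case by simp
  next
    case (Cons p w)
    obtain x e where p: "p = (x, e)" by (cases p)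
    have w: "w \<in> words S" and x: "x \<in> S" using Cons.prems by (auto simp: p words_def)
    then have letter: "[(x, d)] \<in> words S" for d by (auto simp: words_def)
    have "([(x, False), (x, True)], []) \<in> pres_cong S R"
      using pres_cong.cancel[of "[]" S "[]" x False R] x by (simp add: words_def)
    then have "?c [(x, False), (x, True)] = ?c []"
      by (rule equiv_class_eq[OF equiv_pres_cong])
    then have "?c [(x, False)] \<otimes>\<^bsub>?P\<^esub> ?c [(x, True)] = \<one>\<^bsub>?P\<^esub>"
      using letter by (simp add: presented_group_mult) (simp add: presented_group_def)
    then have "?c [(x, False)] = inv\<^bsub>?P\<^esub> ?c [(x, True)]"
      using letter P.inv_equality by (metis pres_cong_class_in_carrier)
    then have e: "\<phi> (?c [(x, e)]) = (if e then \<phi> (?c [(x, True)]) else inv\<^bsub>H\<^esub> \<phi> (?c [(x, True)]))"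
      using letter by (cases e) (simp_all add: pres_cong_class_in_carrier)
    have "?c (p # w) = ?c [(x, e)] \<otimes>\<^bsub>?P\<^esub> ?c w"
      using letter w by (simp add: p presented_group_mult)
    then show ?case
      using letter w e Cons.IH[OF w] by (simp add: p pres_cong_class_in_carrier)
  }
qed

text \<open>The value of a word depends only on its class, because free cancellation never changes it and
  the relations do not by assumption; so it defines a homomorphism on classes. Nothing else is
  possible, since a homomorphism is determined by its values on generators.\<close>

theorem presented_group_universal:
  assumes "group H" and f: "f \<in> S \<rightarrow> carrier H"
    and R: "\<And>r s. (r, s) \<in> R \<Longrightarrow> word_eval H f r = word_eval H f s"
  shows "\<exists>!\<phi>. \<phi> \<in> extensional (carrier (presented_group S R)) \<and>
    \<phi> \<in> hom (presented_group S R) H \<and>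
    (\<forall>x \<in> S. \<phi> (pres_cong S R `` {[(x, True)]}) = f x)"
proof -
  let ?P = "presented_group S R" and ?c = "\<lambda>u. pres_cong S R `` {u}"
  interpret H: group H by fact
  \<comment> \<open>The value of a class may be read off from any of its words.\<close>
  define \<phi> where "\<phi> = (\<lambda>A \<in> carrier ?P. word_eval H f (SOME w. w \<in> A))"
  have \<phi>: "\<phi> (?c u) = word_eval H f u" if u: "u \<in> words S" for u
  proof -
    have "u \<in> ?c u" using u by (auto intro: pres_cong.refl)
    then have "(SOME w. w \<in> ?c u) \<in> ?c u" by (rule someI)
    then have c: "(u, SOME w. w \<in> ?c u) \<in> pres_cong S R" by simp
    have "word_eval H f u = word_eval H f (SOME w. w \<in> ?c u)"
      by (rule H.word_eval_pres_cong[OF f _ c]) (rule R)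
    then show ?thesis using u by (simp add: \<phi>_def pres_cong_class_in_carrier)
  qed
  have hom: "\<phi> \<in> hom ?P H"
  proof (rule homI)
    fix A assume "A \<in> carrier ?P"
    then obtain u where "u \<in> words S" "A = ?c u" by (rule presented_group_carrierE)
    then show "\<phi> A \<in> carrier H" using f by (simp add: \<phi> H.word_eval_closed)
  next
    fix A B assume "A \<in> carrier ?P" "B \<in> carrier ?P"
    then obtain u v where uv: "u \<in> words S" "A = ?c u" "v \<in> words S" "B = ?c v"
      by (metis presented_group_carrierE)
    then have "u @ v \<in> words S" by (auto simp: words_def)
    then show "\<phi> (A \<otimes>\<^bsub>?P\<^esub> B) = \<phi> A \<otimes>\<^bsub>H\<^esub> \<phi> B"
      using uv f by (simp add: presented_group_mult \<phi> H.word_eval_append)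
  qed
  show ?thesis
  proof (rule ex1I[of _ \<phi>], intro conjI ballI)
    show "\<phi> \<in> extensional (carrier ?P)" by (simp add: \<phi>_def)
    show "\<phi> \<in> hom ?P H" by (rule hom)
    fix x assume x: "x \<in> S"
    then have "[(x, True)] \<in> words S" by (auto simp: words_def)
    moreover have "f x \<in> carrier H" using f x by auto
    ultimately show "\<phi> (?c [(x, True)]) = f x" by (simp add: \<phi>)
  next
    fix \<psi> assume "\<psi> \<in> extensional (carrier ?P) \<and> \<psi> \<in> hom ?P H \<and>
      (\<forall>x \<in> S. \<psi> (?c [(x, True)]) = f x)"
    then have \<psi>: "\<psi> \<in> extensional (carrier ?P)" "\<psi> \<in> hom ?P H"
      and gen: "\<And>x. x \<in> S \<Longrightarrow> \<psi> (?c [(x, True)]) = f x" by auto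
    have eval: "word_eval H (\<lambda>x. \<psi> (?c [(x, True)])) u = word_eval H f u" if "u \<in> words S" for u
      using that by (induction u) (auto simp: words_def gen)
    show "\<psi> = \<phi>"
    proof (rule extensionalityI[OF \<psi>(1)])
      show "\<phi> \<in> extensional (carrier ?P)" by (simp add: \<phi>_def)
      fix A assume "A \<in> carrier ?P"
      then obtain u where "u \<in> words S" "A = ?c u" by (rule presented_group_carrierE)
      then show "\<psi> A = \<phi> A"
        using hom_presented_group_word_eval[OF assms(1) \<psi>(2)] by (simp add: eval \<phi>)
    qed
  qed
qed

section \<open>The Gauss-Epple permutations\<close>

definition gauss_epple :: "nat \<Rightarrow> nat \<times> int \<Rightarrow> nat \<times> int" where
  "gauss_epple k = (\<lambda>(a, b).
     if a \<notin> {k, k + 1} then (a, b) else if a = k then (k + 1, b) else (k, b + 1))"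

lemma gauss_epple_braid:
  "gauss_epple k (gauss_epple (k + 1) (gauss_epple k p))
     = gauss_epple (k + 1) (gauss_epple k (gauss_epple (k + 1) p))"
  by (cases p) (auto simp: gauss_epple_def)

lemma gauss_epple_commute:
  "\<bar>int i - int j\<bar> > 1 \<Longrightarrow>
     gauss_epple i (gauss_epple j p) = gauss_epple j (gauss_epple i p)"
  by (cases p) (auto simp: gauss_epple_def)

lemma gauss_epple_Bij:
  assumes "k \<in> {1..n - 1}"
  shows "restrict (gauss_epple k) ({1..n} \<times> UNIV) \<in> Bij ({1..n} \<times> UNIV)"
proof -
  have "bij_betw (gauss_epple k) ({1..n} \<times> UNIV) ({1..n} \<times> UNIV)"
    by (rule bij_betw_byWitness[where f' = "\<lambda>(a, b).
          if a \<notin> {k, k + 1} then (a, b) else if a = k + 1 then (k, b) else (k + 1, b - 1)"])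
       (use assms in \<open>auto simp: gauss_epple_def split: if_splits\<close>)
  then show ?thesis by (simp add: Bij_def bij_betw_restrict_eq)
qed

text \<open>This reduces an equation between products of permutations to an equation between maps.\<close>

lemma word_eval_BijGroup_positive:
  assumes "\<And>k. k \<in> set ks \<Longrightarrow> restrict (g k) E \<in> Bij E"
  shows "word_eval (BijGroup E) (\<lambda>k. restrict (g k) E) (map (\<lambda>k. (k, True)) ks)
           = restrict (foldr g ks) E \<and> restrict (foldr g ks) E \<in> Bij E"
  using assms
proof (induction ks)
  case Nil
  have "restrict id E = (\<lambda>x \<in> E. x)" by auto
  moreover have "word_eval (BijGroup E) (\<lambda>k. restrict (g k) E) [] = (\<lambda>x \<in> E. x)"
    by (simp add: BijGroup_def)
  ultimately show ?case using id_Bij[of E] by (simp only: list.map foldr_Nil)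
next
  case (Cons k ks)
  let ?h = "restrict (foldr g ks) E"
  have k: "restrict (g k) E \<in> Bij E" by (rule Cons.prems) simp
  have "word_eval (BijGroup E) (\<lambda>k. restrict (g k) E) (map (\<lambda>k. (k, True)) ks) = ?h
      \<and> ?h \<in> Bij E"
    by (rule Cons.IH, rule Cons.prems) simp
  then have eval: "word_eval (BijGroup E) (\<lambda>k. restrict (g k) E) (map (\<lambda>k. (k, True)) ks) = ?h"
    and h: "?h \<in> Bij E" by blast+
  have "?h ` E \<subseteq> E" using h by (auto simp: Bij_def bij_betw_def)
  then have "compose E (restrict (g k) E) ?h = restrict (foldr g (k # ks)) E"
    by (auto simp: compose_def fun_eq_iff)
  moreover have "compose E (restrict (g k) E) ?h \<in> Bij E" by (rule compose_Bij[OF k h])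
  moreover have "restrict (g k) E \<otimes>\<^bsub>BijGroup E\<^esub> ?h = compose E (restrict (g k) E) ?h"
    unfolding BijGroup_def monoid.simps restrict_apply'[OF k] restrict_apply'[OF h] ..
  ultimately show ?case by (simp only: list.map word_eval.simps if_True eval simp_thms)
qed

lemma gauss_epple_braid_relations:
  assumes "(r, s) \<in> braid_relations n"
  shows "word_eval (BijGroup ({1..n} \<times> UNIV)) (\<lambda>k. restrict (gauss_epple k) ({1..n} \<times> UNIV)) r
       = word_eval (BijGroup ({1..n} \<times> UNIV)) (\<lambda>k. restrict (gauss_epple k) ({1..n} \<times> UNIV)) s"
proof -
  let ?E = "{1..n} \<times> (UNIV :: int set)"
  have eval: "word_eval (BijGroup ?E) (\<lambda>k. restrict (gauss_epple k) ?E) (map (\<lambda>k. (k, True)) ks)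
      = restrict (foldr gauss_epple ks) ?E" if "set ks \<subseteq> {1..n - 1}" for ks
    using that by (intro word_eval_BijGroup_positive[THEN conjunct1] gauss_epple_Bij) auto
  from assms consider
    (braid) i where "1 \<le> i" "i + 2 \<le> n"
      "r = map (\<lambda>k. (k, True)) [i, i + 1, i]" "s = map (\<lambda>k. (k, True)) [i + 1, i, i + 1]"
  | (commute) i j where "i \<in> {1..n - 1}" "j \<in> {1..n - 1}" "\<bar>int i - int j\<bar> > 1"
      "r = map (\<lambda>k. (k, True)) [i, j]" "s = map (\<lambda>k. (k, True)) [j, i]"
    unfolding braid_relations_def by auto
  then show ?thesis
  proof cases
    case braid
    have "foldr gauss_epple [i, i + 1, i] = foldr gauss_epple [i + 1, i, i + 1]"
      using gauss_epple_braid[of i] by (simp add: fun_eq_iff)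
    moreover have "set [i, i + 1, i] \<subseteq> {1..n - 1}" "set [i + 1, i, i + 1] \<subseteq> {1..n - 1}"
      using braid by auto
    ultimately show ?thesis by (simp only: braid(3,4) eval)
  next
    case commute
    have "foldr gauss_epple [i, j] = foldr gauss_epple [j, i]"
      using gauss_epple_commute[OF commute(3)] by (simp add: fun_eq_iff)
    moreover have "set [i, j] \<subseteq> {1..n - 1}" "set [j, i] \<subseteq> {1..n - 1}"
      using commute by auto
    ultimately show ?thesis by (simp only: commute(4,5) eval)
  qed
qed

section \<open>The Gauss-Epple action\<close>

theorem lemma2p2:
  fixes n :: nat
  assumes "n \<ge> 2"
  shows "\<exists>!GE. GE \<in> extensional (carrier (braid_group n)) \<and>
    group_action (braid_group n) ({1..n} \<times> (UNIV :: int set)) GE \<and>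
    (\<forall>k \<in> {1..n - 1}. \<forall>(a, b) \<in> {1..n} \<times> (UNIV :: int set).
       GE (artin n k) (a, b) =
         (if a \<notin> {k, k + 1} then (a, b)
          else if a = k then (k + 1, b)
          else (k, b + 1)))"
proof -
  let ?E = "{1..n} \<times> (UNIV :: int set)"
  let ?f = "\<lambda>k. restrict (gauss_epple k) ?E"
  have action: "group_action (braid_group n) ?E GE \<longleftrightarrow> GE \<in> hom (braid_group n) (BijGroup ?E)" for GE
    unfolding group_action_def group_hom_def group_hom_axioms_def
    using group_braid_group group_BijGroup by auto
  \<comment> \<open>A permutation in \<open>BijGroup\<close> is undefined outside the set, so that it is determined by its
    values on the set.\<close>
  have prescribed: "GE (artin n k) = ?f k \<longleftrightarrow>
      (\<forall>(a, b) \<in> ?E. GE (artin n k) (a, b) =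
         (if a \<notin> {k, k + 1} then (a, b) else if a = k then (k + 1, b) else (k, b + 1)))"
    if "GE \<in> hom (braid_group n) (BijGroup ?E)" and k: "k \<in> {1..n - 1}" for GE k
  proof -
    have "[(k, True)] \<in> words {1..n - 1}" using k by (auto simp: words_def)
    then have "artin n k \<in> carrier (braid_group n)"
      unfolding artin_def braid_group_def by (rule pres_cong_class_in_carrier)
    then have "GE (artin n k) \<in> carrier (BijGroup ?E)" using that(1) by (rule hom_in_carrier[rotated])
    then have "GE (artin n k) \<in> extensional ?E" by (simp add: BijGroup_def Bij_def)
    then have "GE (artin n k) = ?f k \<longleftrightarrow> (\<forall>p \<in> ?E. GE (artin n k) p = gauss_epple k p)"
      by (metis (no_types, lifting) extensionalityI restrict_apply' restrict_extensional)
    then show ?thesis by (simp add: gauss_epple_def case_prod_beta)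
  qed
  have "?f \<in> {1..n - 1} \<rightarrow> carrier (BijGroup ?E)"
    using gauss_epple_Bij by (auto simp: BijGroup_def)
  then have "\<exists>!GE. GE \<in> extensional (carrier (braid_group n)) \<and>
      GE \<in> hom (braid_group n) (BijGroup ?E) \<and> (\<forall>k \<in> {1..n - 1}. GE (artin n k) = ?f k)"
    unfolding braid_group_def artin_def
    by (rule presented_group_universal[OF group_BijGroup]) (rule gauss_epple_braid_relations)
  then show ?thesis
    by (simp only: action prescribed cong: conj_cong ball_cong)
qed

end
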